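(* Let $D$ be a distance on a set $X$ with $n\geq 1$ elements. Then the midpath split system satisfies $|\mathcal{S}_D|\leq n(n-1)$. Moreover, for all sufficiently large $n\in\mathbb{N}$ this bound is tight, i.e. there exists a distance $D$ on an $n$-element set $X$ with $|\mathcal{S}_D| = n(n-1)$.
   Context: A distance on a finite non-empty set $X$ is a symmetric map $D: X\times X\to\mathbb{R}$ with $D(x,x)=0$ and $D(x,y)\geq 0$ for all $x,y$. A split of $X$ is a bipartition $\{A,B\}$ of $X$ into two non-empty sets, written $A|B$. For $u\neq v$ in $X$ let $X_{u,v}=\{x\in X: D(u,x)<D(v,x)\}$. The midpath split system of $D$ is $\mathcal{S}_D=\{X_{u,v}|X-X_{u,v} : u,v\in X,\ u\neq v,\ \emptyset\subsetneq X_{u,v}\subsetneq X\}$. *)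

theory Defs
  imports Complex_Main
begin

text \<open>
  A distance is a function on the whole type, but only its values on the carrier \<open>X\<close> matter.
  Neither the triangle inequality nor positivity for distinct points is required.
\<close>

definition distance_on :: "'a set \<Rightarrow> ('a \<Rightarrow> 'a \<Rightarrow> real) \<Rightarrow> bool" where
  "distance_on X D \<longleftrightarrow> finite X \<and> X \<noteq> {} \<and>
     (\<forall>x\<in>X. \<forall>y\<in>X. D x y = D y x) \<and>
     (\<forall>x\<in>X. D x x = 0) \<and>
     (\<forall>x\<in>X. \<forall>y\<in>X. 0 \<le> D x y)"

text \<open>A split \<open>A|B\<close> is the unordered pair \<open>{A, B}\<close>, so that \<open>A|B = B|A\<close>.\<close>

definition splits :: "'a set \<Rightarrow> 'a set set set" where
  "splits X = {{A, B} | A B. A \<noteq> {} \<and> B \<noteq> {} \<and> A \<inter> B = {} \<and> A \<union> B = X}"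

definition closer :: "'a set \<Rightarrow> ('a \<Rightarrow> 'a \<Rightarrow> real) \<Rightarrow> 'a \<Rightarrow> 'a \<Rightarrow> 'a set" where
  "closer X D u v = {x \<in> X. D u x < D v x}"

definition midpath_splits :: "'a set \<Rightarrow> ('a \<Rightarrow> 'a \<Rightarrow> real) \<Rightarrow> 'a set set set" where
  "midpath_splits X D =
     {{closer X D u v, X - closer X D u v} | u v.
        u \<in> X \<and> v \<in> X \<and> u \<noteq> v \<and> {} \<subset> closer X D u v \<and> closer X D u v \<subset> X}"

lemma midpath_splits_subset_splits: "midpath_splits X D \<subseteq> splits X"
  unfolding midpath_splits_def splits_def by blast

end

(* Splits are indexed by ordered pairs, which gives the upper bound. For tightness, the points
   10, 11, ... form a chain with distances about 2 * min x y: there closer(u, v) is {u, ...} - {v}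
   and closer(v, u) is {v, u - 1} if u < v, so within one class of pairs the chain part of the set
   already determines the pair. The points 0, ..., 9 form a gadget: the trace of closer(u, v) on
   these ten points tells, even up to complement, whether u and v lie in the gadget (and then
   which points they are) and how they are ordered if both lie in the chain. *)
theory Submission
  imports Defs
begin

section \<open>The ten-point gadget and its signatures\<close>

text \<open>
  Rows 0 to 9 are the distances inside the gadget; they were found by a computer search for
  \<open>distinct_signatures\<close>. Rows 10 and 11 describe how a chain point sees the gadget: only the order
  of its entries relative to the other rows matters, and row 11 stands for the larger of two
  chain points.
\<close>

definition table :: "nat list list" where
  "table =
    [[0, 3, 3, 2, 1, 2, 2, 3, 1, 2],
     [3, 0, 1, 3, 2, 3, 1, 2, 1, 1],
     [3, 1, 0, 1, 2, 1, 3, 3, 2, 3],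
     [2, 3, 1, 0, 2, 3, 1, 3, 3, 2],
     [1, 2, 2, 2, 0, 3, 2, 1, 3, 3],
     [2, 3, 1, 3, 3, 0, 1, 1, 2, 2],
     [2, 1, 3, 1, 2, 1, 0, 1, 1, 3],
     [3, 2, 3, 3, 1, 1, 1, 0, 3, 2],
     [1, 1, 2, 3, 3, 2, 1, 3, 0, 3],
     [2, 1, 3, 2, 3, 2, 3, 2, 3, 0],
     [4, 2, 2, 2, 2, 2, 2, 2, 2, 2],
     [5, 2, 2, 2, 2, 2, 2, 2, 2, 2]]"

definition tab :: "nat \<Rightarrow> nat \<Rightarrow> nat" where
  "tab a x = table ! a ! x"

definition signature :: "nat \<Rightarrow> nat \<Rightarrow> bool list" where
  "signature a b = map2 (<) (table ! a) (table ! b)"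

text \<open>A representative modulo complement, since an unordered split does not tell which side is
  the closer set.\<close>

definition normalize_signs :: "bool list \<Rightarrow> bool list" where
  "normalize_signs bs = (if hd bs then bs else map Not bs)"

text \<open>Row 11 occurs only opposite row 10, because it makes sense only for two chain
  points.\<close>

definition rank_pairs :: "(nat \<times> nat) list" where
  "rank_pairs = [(a, b). a \<leftarrow> [0..<12], b \<leftarrow> [0..<12],
     a \<noteq> b \<and> (a = 11 \<longrightarrow> b = 10) \<and> (b = 11 \<longrightarrow> a = 10)]"

text \<open>A finite computation; it lets the gadget trace of either side of a split determine the
  pair of rows.\<close>

lemma distinct_signatures:
  "distinct (map (\<lambda>(a, b). normalize_signs (signature a b)) rank_pairs)"
  by code_simp

lemma tab_sym: "\<forall>x\<in>{0..<10}. \<forall>y\<in>{0..<10}. tab x y = tab y x"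
  by code_simp

lemma tab_diag: "\<forall>x\<in>{0..<10}. tab x x = 0"
  by code_simp

lemma tab_range: "\<forall>x\<in>{0..<10}. \<forall>y\<in>{0..<10}. x \<noteq> y \<longrightarrow> 0 < tab x y \<and> tab x y \<le> 3"
  by code_simp

lemma length_table: "\<forall>x\<in>{0..<12}. length (table ! x) = 10"
  by code_simp

lemma tab_chain: "\<forall>x\<in>{0..<10}. tab 10 x = (if x = 0 then 4 else 2) \<and> tab 11 x = (if x = 0 then 5 else 2)"
  by code_simp

lemma normalize_signs_Not: "bs \<noteq> [] \<Longrightarrow> normalize_signs (map Not bs) = normalize_signs bs"
  by (cases bs) (auto simp: normalize_signs_def o_def)

lemma signature_conv:
  assumes "a < 12" "b < 12"
  shows "signature a b = map (\<lambda>x. tab a x < tab b x) [0..<10]"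
  using assms length_table
  by (intro nth_equalityI) (auto simp: signature_def tab_def)

section \<open>The distance on gadget and chain\<close>

text \<open>
  The value \<open>4 - 1 / x\<close> exceeds all distances inside the gadget, stays below all distances inside
  the chain, and increases with \<open>x\<close>, so the point \<open>0\<close> detects the order of two chain points.
  Since \<open>x\<close> and \<open>x + 1\<close> are slightly further apart, the point \<open>u - 1\<close> marks \<open>u\<close> in the
  set of the pair \<open>(v, u)\<close> with \<open>u < v\<close>.
\<close>

definition mid_dist :: "nat \<Rightarrow> nat \<Rightarrow> real" where
  "mid_dist x y =
     (if x = y then 0
      else if x < 10 \<and> y < 10 then real (tab x y)
      else if min x y = 0 then 4 - 1 / real (max x y)
      else if min x y < 10 then 2
      else 2 * real (min x y) + (if y = Suc x \<or> x = Suc y then 1 else 0))"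

lemma mid_dist_sym: "mid_dist x y = mid_dist y x"
  using tab_sym by (auto simp: mid_dist_def min.commute max.commute)

lemma mid_dist_refl [simp]: "mid_dist x x = 0"
  by (simp add: mid_dist_def)

lemma mid_dist_pos:
  assumes "x \<noteq> y"
  shows "0 < mid_dist x y"
proof -
  have "1 / real (max x y) < 4" if "\<not> (x < 10 \<and> y < 10)"
    using that by (auto simp: divide_less_eq max_def)
  then show ?thesis
    using assms tab_range by (auto simp: mid_dist_def min_def)
qed

lemma distance_on_mid_dist: "n \<ge> 1 \<Longrightarrow> distance_on {..<n} mid_dist"
  by (auto simp: distance_on_def mid_dist_sym lessThan_empty_iff)
     (metis mid_dist_pos mid_dist_refl less_eq_real_def)

section \<open>Traces on the gadget\<close>

text \<open>The row of \<open>table\<close> that describes \<open>u\<close> when it is compared with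
  \<open>v\<close>.\<close>

definition rank :: "nat \<Rightarrow> nat \<Rightarrow> nat" where
  "rank u v = (if u < 10 then u else if 10 \<le> v \<and> v < u then 11 else 10)"

lemma rank_less: "rank u v < 12"
  by (auto simp: rank_def)

lemma rank_in_rank_pairs: "u \<noteq> v \<Longrightarrow> (rank u v, rank v u) \<in> set rank_pairs"
  by (auto simp: rank_pairs_def rank_def)

lemma mid_dist_tab: "x < 10 \<Longrightarrow> y < 10 \<Longrightarrow> mid_dist x y = real (tab x y)"
  using tab_diag by (auto simp: mid_dist_def)

lemma mid_dist_0: "10 \<le> x \<Longrightarrow> mid_dist x 0 = 4 - 1 / real x"
  by (auto simp: mid_dist_def)

lemma mid_dist_const: "0 < g \<Longrightarrow> g < 10 \<Longrightarrow> 10 \<le> x \<Longrightarrow> mid_dist x g = 2"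
  by (auto simp: mid_dist_def min_def)

text \<open>At the points 1 to 9 a chain point has distance 2, as in rows 10 and 11. At 0 the gadget
  distances are at most 3, while chain distances exceed 3 and grow along the chain, like the entries
  4 and 5.\<close>

lemma mid_dist_less_iff_tab:
  assumes "x < 10" "u \<noteq> v"
  shows "mid_dist u x < mid_dist v x \<longleftrightarrow> tab (rank u v) x < tab (rank v u) x"
proof -
  have tab_le: "real (tab w x) \<le> 3" if "w < 10" for w
    using that assms tab_range tab_diag by (cases "w = x") auto
  have chain: "tab 10 x = (if x = 0 then 4 else 2)" "tab 11 x = (if x = 0 then 5 else 2)"
    using tab_chain assms by auto
  have frac: "3 < 4 - 1 / real w" if "10 \<le> w" for w :: nat
    using that by (simp add: field_simps)
  have frac_mono: "4 - 1 / real w < 4 - 1 / real w' \<longleftrightarrow> w < w'" if "10 \<le> w" "10 \<le> w'" for w w' :: nat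
    using that by (simp add: field_simps)
  consider "u < 10" "v < 10" | "u < 10" "10 \<le> v" | "10 \<le> u" "v < 10" | "10 \<le> u" "10 \<le> v"
    by linarith
  then show ?thesis
  proof cases
    case 1
    then show ?thesis using assms by (simp add: mid_dist_tab rank_def)
  next
    case 2
    show ?thesis
    proof (cases "x = 0")
      case True
      then show ?thesis
        using 2 assms chain tab_le[of u] le_less_trans[OF tab_le frac, of u v]
        by (simp add: mid_dist_tab mid_dist_0 rank_def)
    next
      case False
      then show ?thesis
        using 2 assms chain by (simp add: mid_dist_tab mid_dist_const rank_def)
    qed
  next
    case 3
    show ?thesis
    proof (cases "x = 0")
      case True
      then show ?thesis
        using 3 assms chain tab_le[of v] le_less_trans[OF tab_le frac, of v u]
        by (simp add: mid_dist_tab mid_dist_0 rank_def)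
    next
      case False
      then show ?thesis
        using 3 assms chain by (simp add: mid_dist_tab mid_dist_const rank_def)
    qed
  next
    case 4
    show ?thesis
    proof (cases "x = 0")
      case True
      then show ?thesis
        using 4 assms chain frac_mono[of u v] by (auto simp: mid_dist_0 rank_def)
    next
      case False
      then show ?thesis
        using 4 assms chain by (simp add: mid_dist_const rank_def)
    qed
  qed
qed

lemma signature_rank:
  assumes "10 \<le> n" "u \<noteq> v"
  shows "signature (rank u v) (rank v u) = map (\<lambda>x. x \<in> closer {..<n} mid_dist u v) [0..<10]"
  using assms by (auto simp: signature_conv rank_less closer_def mid_dist_less_iff_tab)

section \<open>Traces on the chain and recovery of the pair\<close>

text \<open>A chain point is within 4 of every gadget point, but at least 20 away from every other
  chain point.\<close>

lemma chain_gadget_less: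
  assumes "10 \<le> x" "g < 10" "10 \<le> v"
  shows "mid_dist g x < mid_dist v x \<longleftrightarrow> x \<noteq> v"
    and "mid_dist v x < mid_dist g x \<longleftrightarrow> x = v"
proof -
  have *: "0 < mid_dist g x" "mid_dist g x \<le> 4"
    using mid_dist_pos[of g x] assms by (auto simp: mid_dist_def)
  moreover have "20 \<le> mid_dist v x" if "x \<noteq> v"
    using assms that by (auto simp: mid_dist_def min_def)
  ultimately show "mid_dist g x < mid_dist v x \<longleftrightarrow> x \<noteq> v"
      "mid_dist v x < mid_dist g x \<longleftrightarrow> x = v"
    by (cases "x = v"; force)+
qed

text \<open>For \<open>x < u\<close> both distances are \<open>2 * x\<close>, except that the
  neighbour \<open>u - 1\<close> is farther from \<open>u\<close> by 1. For \<open>x > u\<close>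
  with \<open>x \<noteq> v\<close>, the smaller minimum puts \<open>u\<close> closer despite the
  extra 1.\<close>

lemma chain_chain_less:
  assumes "10 \<le> x" "10 \<le> u" "u < v"
  shows "mid_dist u x < mid_dist v x \<longleftrightarrow> u \<le> x \<and> x \<noteq> v"
    and "mid_dist v x < mid_dist u x \<longleftrightarrow> x = v \<or> Suc x = u"
proof -
  consider "x < u" | "x = u" | "u < x" "x < v" | "x = v" | "v < x"
    by linarith
  then have "(mid_dist u x < mid_dist v x \<longleftrightarrow> u \<le> x \<and> x \<noteq> v) \<and>
      (mid_dist v x < mid_dist u x \<longleftrightarrow> x = v \<or> Suc x = u)"
    by cases (use assms in \<open>simp_all add: mid_dist_def min_def\<close>)
  then show "mid_dist u x < mid_dist v x \<longleftrightarrow> u \<le> x \<and> x \<noteq> v"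
      "mid_dist v x < mid_dist u x \<longleftrightarrow> x = v \<or> Suc x = u"
    by simp_all
qed

lemma closer_mid_dist_inj:
  assumes n: "10 \<le> n" and uv: "u < n" "v < n" "u \<noteq> v" and uv': "u' < n" "v' < n" "u' \<noteq> v'"
    and eq: "closer {..<n} mid_dist u v = closer {..<n} mid_dist u' v' \<or>
      closer {..<n} mid_dist u v = {..<n} - closer {..<n} mid_dist u' v'"
  shows "u = u' \<and> v = v'"
proof -
  let ?C = "closer {..<n} mid_dist"
  let ?s = "\<lambda>a b. map (\<lambda>x. x \<in> ?C a b) [0..<10]"
  have "?s u v = ?s u' v' \<or> ?s u v = map Not (?s u' v')"
    using eq
  proof
    assume "?C u v = {..<n} - ?C u' v'"
    then have "x \<in> ?C u v \<longleftrightarrow> x \<notin> ?C u' v'" if "x < 10" for x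
      using that n by simp
    then show ?thesis
      by simp
  qed simp
  then have "normalize_signs (?s u v) = normalize_signs (?s u' v')"
    by (metis (no_types, lifting) normalize_signs_Not list.map_disc_iff upt_eq_Nil_conv
        zero_neq_numeral le_zero_eq)
  then have "normalize_signs (signature (rank u v) (rank v u)) =
      normalize_signs (signature (rank u' v') (rank v' u'))"
    unfolding signature_rank[OF n uv(3)] signature_rank[OF n uv'(3)] .
  moreover have inj: "inj_on (\<lambda>(a, b). normalize_signs (signature a b)) (set rank_pairs)"
    using distinct_signatures by (simp add: distinct_map)
  ultimately have "(rank u v, rank v u) = (rank u' v', rank v' u')"
    by (intro inj_onD[OF inj] rank_in_rank_pairs uv uv') simp
  then have ranks: "rank u v = rank u' v'" "rank v u = rank v' u'"
    by simp_all
  \<comment> \<open>Equal ranks put 0 on the same side for both pairs, which rules out the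
    complementary alternative.\<close>
  then have "0 \<in> ?C u v \<longleftrightarrow> 0 \<in> ?C u' v'"
    using n uv uv' by (simp add: closer_def mid_dist_less_iff_tab)
  moreover have "0 \<in> {..<n}"
    using n by simp
  ultimately have "?C u v = ?C u' v'"
    using eq by (metis DiffD2 DiffI)
  then have C: "mid_dist u x < mid_dist v x \<longleftrightarrow> mid_dist u' x < mid_dist v' x" if "x < n" for x
    using that by (simp add: closer_def set_eq_iff) blast
  consider "u < 10" "v < 10" | "u < 10" "10 \<le> v" | "10 \<le> u" "v < 10"
    | "10 \<le> u" "u < v" | "10 \<le> v" "v < u"
    using uv by linarith
  then show ?thesis
  proof cases
    case 1
    then show ?thesis using ranks by (auto simp: rank_def split: if_splits)
  next
    case 2
    then have "u' = u" "10 \<le> v'" using ranks by (auto simp: rank_def split: if_splits)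
    \<comment> \<open>\<open>v\<close> is the only chain point outside the set; in the next case
      \<open>u\<close> is the only one inside.\<close>
    then show ?thesis using 2 uv C[of v] chain_gadget_less(1)[of v u v] chain_gadget_less(1)[of v u v'] by simp
  next
    case 3
    then have "v' = v" "10 \<le> u'" using ranks by (auto simp: rank_def split: if_splits)
    then show ?thesis using 3 uv C[of u] chain_gadget_less(2)[of u v u] chain_gadget_less(2)[of u v u'] by simp
  next
    case 4
    then have chain': "10 \<le> u'" "u' < v'" using ranks uv' by (auto simp: rank_def split: if_splits)
    have iff: "u \<le> x \<and> x \<noteq> v \<longleftrightarrow> u' \<le> x \<and> x \<noteq> v'" if "x < n" "10 \<le> x" for x
      using C[OF that(1)] chain_chain_less(1)[OF that(2)] 4 chain' by simp
    \<comment> \<open>The chain part has least element \<open>u\<close>, and \<open>v\<close> is the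
      only later point missing.\<close>
    have "u = u'"
      using iff[of u] iff[of u'] uv uv' 4 chain' by auto
    then show ?thesis
      using iff[of v] uv 4 by auto
  next
    case 5
    then have chain': "10 \<le> v'" "v' < u'" using ranks uv' by (auto simp: rank_def split: if_splits)
    have iff: "x = u \<or> Suc x = v \<longleftrightarrow> x = u' \<or> Suc x = v'" if "x < n" "10 \<le> x" for x
      using C[OF that(1)] chain_chain_less(2)[OF that(2)] 5 chain' by simp
    have "u = u'"
      using iff[of u] iff[of u'] uv uv' 5 chain' by auto
    moreover have "v = v'"
    \<comment> \<open>The point \<open>v - 1\<close> lies in the chain only if
      \<open>v > 10\<close>. The larger of \<open>v\<close> and \<open>v'\<close> does exceed 10, so
      its predecessor separates the two sets.\<close>
    proof (rule ccontr)
      assume "v \<noteq> v'"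
      then consider "v' < v" | "v < v'"
        by linarith
      then show False
        using iff[of "v - 1"] iff[of "v' - 1"] uv uv' 5 chain' \<open>u = u'\<close> by cases auto
    qed
    ultimately show ?thesis
      by simp
  qed
qed

lemma Collect_pairs_conv_image: "{f u v | u v. P u v} = (\<lambda>(u, v). f u v) ` {(u, v). P u v}"
  by auto

lemma midpath_splits_conv_image:
  "midpath_splits X D = (\<lambda>(u, v). {closer X D u v, X - closer X D u v}) `
     {(u, v). u \<in> X \<and> v \<in> X \<and> u \<noteq> v \<and> {} \<subset> closer X D u v \<and> closer X D u v \<subset> X}"
  unfolding midpath_splits_def by (rule Collect_pairs_conv_image)

lemma finite_off_diagonal: "finite X \<Longrightarrow> finite {(u, v). u \<in> X \<and> v \<in> X \<and> u \<noteq> v}"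
  by (rule finite_subset[of _ "X \<times> X"]) auto

lemma card_off_diagonal:
  assumes "finite X"
  shows "card {(u, v). u \<in> X \<and> v \<in> X \<and> u \<noteq> v} = card X * (card X - 1)"
proof -
  have "{(u, v). u \<in> X \<and> v \<in> X \<and> u \<noteq> v} = Sigma X (\<lambda>u. X - {u})"
    by auto
  then show ?thesis
    using assms by simp
qed

lemma card_midpath_splits_le:
  assumes "finite X"
  shows "card (midpath_splits X D) \<le> card X * (card X - 1)"
proof -
  have "card (midpath_splits X D) \<le> card {(u, v). u \<in> X \<and> v \<in> X \<and> u \<noteq> v}"
    unfolding midpath_splits_conv_image
    by (rule surj_card_le[OF finite_off_diagonal[OF assms]]) auto
  then show ?thesis
    using assms by (simp add: card_off_diagonal)
qed

lemma card_midpath_splits_mid_dist: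
  assumes "10 \<le> n"
  shows "card (midpath_splits {..<n} mid_dist) = n * (n - 1)"
proof -
  let ?C = "closer {..<n} mid_dist"
  let ?P = "{(u, v). u \<in> {..<n} \<and> v \<in> {..<n} \<and> u \<noteq> v}"
  \<comment> \<open>Distances off the diagonal are positive, so every ordered pair yields a
    split.\<close>
  have "u \<in> ?C u v" "v \<notin> ?C u v" "?C u v \<subseteq> {..<n}" if "(u, v) \<in> ?P" for u v
    using that mid_dist_pos[of u v] mid_dist_pos[of v u] by (auto simp: closer_def)
  then have "{(u, v). u \<in> {..<n} \<and> v \<in> {..<n} \<and> u \<noteq> v \<and> {} \<subset> ?C u v \<and> ?C u v \<subset> {..<n}} = ?P"
    by blast
  then have "midpath_splits {..<n} mid_dist = (\<lambda>(u, v). {?C u v, {..<n} - ?C u v}) ` ?P"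
    unfolding midpath_splits_conv_image by simp
  moreover have "inj_on (\<lambda>(u, v). {?C u v, {..<n} - ?C u v}) ?P"
  proof (rule inj_onI)
    fix p q
    assume pq: "p \<in> ?P" "q \<in> ?P"
      and eq: "(\<lambda>(u, v). {?C u v, {..<n} - ?C u v}) p = (\<lambda>(u, v). {?C u v, {..<n} - ?C u v}) q"
    obtain u v u' v' where [simp]: "p = (u, v)" "q = (u', v')"
      by (cases p, cases q)
    have "?C u v = ?C u' v' \<or> ?C u v = {..<n} - ?C u' v'"
      using eq by (simp add: doubleton_eq_iff) blast
    then show "p = q"
      using pq closer_mid_dist_inj[OF assms, of u v u' v'] by simp
  qed
  ultimately show ?thesis
    by (simp only: card_image card_off_diagonal[OF finite_lessThan] card_lessThan)
qed

theorem theorem2: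
  "(\<forall>(X :: 'a set) D n. distance_on X D \<and> card X = n \<and> n \<ge> 1 \<longrightarrow>
      card (midpath_splits X D) \<le> n * (n - 1)) \<and>
   (\<exists>N. \<forall>n\<ge>N. \<exists>(X :: nat set) D. distance_on X D \<and> card X = n \<and>
      card (midpath_splits X D) = n * (n - 1))"
\<comment> \<open>The threshold 10 is the size of the gadget; the chain may be empty.\<close>
proof (intro conjI exI[of _ 10] allI impI)
  fix X :: "'a set" and D n
  assume "distance_on X D \<and> card X = n \<and> n \<ge> 1"
  then show "card (midpath_splits X D) \<le> n * (n - 1)"
    using card_midpath_splits_le[of X D] by (auto simp: distance_on_def)
next
  fix n :: nat
  assume "10 \<le> n"
  then show "\<exists>(X :: nat set) D. distance_on X D \<and> card X = n \<and>
      card (midpath_splits X D) = n * (n - 1)"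
    using card_midpath_splits_mid_dist distance_on_mid_dist
    by (intro exI[of _ "{..<n}"] exI[of _ mid_dist]) auto
qed

end
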